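(* Let $(F^*,\mathrm{d},\wedge)$ be a differential graded algebra, $\delta:F^n\to F^{n-1}$ a linear map for all $n$, $\alpha\in\mathbb{R}$, and let $(F_{\mathbb{R}}^*,\mathrm{d}_\alpha,\wedge_\alpha)$, $(F_{\mathbb{R}}^*,\mathrm{d}_0,\wedge_0)$ and the DGA isomorphism $\mathcal{I}$ be as in the context. Let $\nabla:F^n\to F^1\otimes_{F^0}F^n$ be a left covariant derivative, and let $\nabla_0:F_{\mathbb{R}}^n\to F_{\mathbb{R}}^1\otimes_0F_{\mathbb{R}}^n$ be the left covariant derivative (for $\mathrm{d}_0,\wedge_0$) obtained by adding time, with $\nabla_0(\xi)=\nabla(\xi)+\mathrm{d}t\otimes\frac{\partial\xi}{\partial t}$, where $\nabla(\xi)(t)=\nabla(\xi(t))$. Then $(\mathcal{I}\otimes\mathcal{I})(\xi\otimes\eta)=\mathcal{I}(\xi)\otimes\mathcal{I}(\eta)$ gives a well-defined map $\mathcal{I}\otimes\mathcal{I}:F_{\mathbb{R}}^1\otimes_0F_{\mathbb{R}}^n\to F_{\mathbb{R}}^1\otimes_\alpha F_{\mathbb{R}}^n$, and $$\nabla_\alpha=(\mathcal{I}\otimes\mathcal{I})\,\nabla_0\,\mathcal{I}^{-1}:F_{\mathbb{R}}^n\to F_{\mathbb{R}}^1\otimes_\alpha F_{\mathbb{R}}^n$$ is a left covariant derivative for the deformed calculus, i.e. for all $f\in F_{\mathbb{R}}^0$ and $\eta\in F_{\mathbb{R}}^n$ $$\nabla_\alpha(f\wedge_\alpha\eta)=\m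athrm{d}_\alpha(f)\otimes\eta+f\wedge_\alpha\nabla_\alpha(\eta).$$
   Context: A differential graded algebra (DGA) $(F^*,\mathrm{d},\wedge)$ consists of vector spaces $F^n$, $n\ge 0$, over $k=\mathbb{R}$ or $\mathbb{C}$ (with $F^n=0$ for $n<0$), linear maps $\mathrm{d}:F^n\to F^{n+1}$ and an associative bilinear product $\wedge:F^n\times F^m\to F^{n+m}$ with $\mathrm{d}\,\mathrm{d}=0$ and $\mathrm{d}(\xi\wedge\eta)=\mathrm{d}\xi\wedge\eta+(-1)^{|\xi|}\xi\wedge \mathrm{d}\eta$. Put $\Delta=\delta\,\mathrm{d}+\mathrm{d}\,\delta$ and $F_{\mathbb{R}}^n=F^n\otimes C^\infty(\mathbb{R})\oplus\big(F^{n-1}\otimes C^\infty(\mathbb{R})\big)\wedge \mathrm{d}t$, where $\wedge \mathrm{d}t$ is a formal marker and $\mathrm{d},\wedge,\delta,\Delta$ act pointwise in $t$. For $\xi\in F^n\otimes C^\infty(\mathbb{R})$, $\eta\in F^m\otimes C^\infty(\mathbb{R})$: $\mathrm{d}_\alpha(\xi)=\mathrm{d}\xi+(-1)^n\frac{\partial\xi}{\partial t}\wedge \mathrm{d}t+(-1)^n\alpha\Delta(\xi)\wedge \mathrm{d}t$; $\mathrm{d}_\alpha(\xi\wedge \mathrm{d}t)=\mathrm{d}\xi\wedge \mathrm{d}t$; $\xi\wedge_\alpha\eta=\xi\wedge\eta-(-1)^{n+m}\alpha(\delta(\xi\wedge\eta)-\delta(\xi)\wedge\eta-(-1)^n\xi\wedge\delta(\eta))\wedge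 \mathrm{d}t$; $(\xi\wedge \mathrm{d}t)\wedge_\alpha\eta=(-1)^m(\xi\wedge\eta)\wedge \mathrm{d}t$; $\xi\wedge_\alpha(\eta\wedge \mathrm{d}t)=(\xi\wedge\eta)\wedge \mathrm{d}t$; $(\xi\wedge \mathrm{d}t)\wedge_\alpha(\eta\wedge \mathrm{d}t)=0$. These make $F_{\mathbb{R}}^*$ a DGA for every $\alpha$. The map $\mathcal{I}(\xi)=\xi-(-1)^n\alpha\,\delta(\xi)\wedge \mathrm{d}t$, $\mathcal{I}(\xi\wedge \mathrm{d}t)=\xi\wedge \mathrm{d}t$ is a DGA isomorphism from $(F_{\mathbb{R}}^*,\mathrm{d}_0,\wedge_0)$ to $(F_{\mathbb{R}}^*,\mathrm{d}_\alpha,\wedge_\alpha)$. $F_{\mathbb{R}}^n\otimes_\alpha F_{\mathbb{R}}^m$ denotes the tensor product over the algebra $F_{\mathbb{R}}^0$ with the bimodule structures given by $\wedge_\alpha$, so that $(\xi\wedge_\alpha f)\otimes\eta=\xi\otimes(f\wedge_\alpha\eta)$; $\otimes_0$ is the case $\alpha=0$. It is a left $F^0_{\mathbb{R}}$-module by $f\wedge_\alpha(\xi\otimes\eta)=(f\wedge_\alpha\xi)\otimes\eta$. A left covariant derivative on $n$-forms of a DGA is a linear map $\nabla:F^n\to F^1\otimes_{F^0}F^n$ with $\nabla(f.\xi)=\mathrm{d}f\otimes\xi+f.\nabla(\xi)$ for $f\in F^0$, $\xi\in F^n$. The displayed formula for $\nabla_0$ refers to $\xi\in F^n\otimes C^\infty(\mathbb{R})$;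 $\nabla_0$ is taken to be a left covariant derivative on all of $F_{\mathbb{R}}^n$. *)

theory Defs
  imports
    "HOL-Analysis.Analysis"
    "HOL-Algebra.Free_Abelian_Groups"
    "HOL-Library.Function_Algebras"
begin

section \<open>Differential graded algebras\<close>

text \<open>
  The ground field is a type of class \<^class>\<open>real_normed_field\<close>; up to isomorphism such a field
  is \<open>\<real>\<close> or \<open>\<complex>\<close>. The graded pieces are subspaces of one ambient vector space, and the
  operations are indexed by degree, so the pieces need not be independent (or even disjoint) there.
  The algebra is unital: the form \<open>dt = 1 \<and> dt\<close> used below needs a unit in degree \<open>0\<close>.
\<close>

record ('k, 'a) dga_data =
  scal :: "'k \<Rightarrow> 'a \<Rightarrow> 'a"
  forms :: "int \<Rightarrow> 'a set"
  dif :: "int \<Rightarrow> 'a \<Rightarrow> 'a"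
  wedge :: "int \<Rightarrow> int \<Rightarrow> 'a \<Rightarrow> 'a \<Rightarrow> 'a"
  unit_form :: 'a

definition lin_map ::
  "('k \<Rightarrow> 'a \<Rightarrow> 'a) \<Rightarrow> 'a set \<Rightarrow> 'a set \<Rightarrow> ('a \<Rightarrow> 'a::plus) \<Rightarrow> bool" where
  "lin_map s V W f \<longleftrightarrow>
     f \<in> V \<rightarrow> W \<and>
     (\<forall>x\<in>V. \<forall>y\<in>V. f (x + y) = f x + f y) \<and>
     (\<forall>c. \<forall>x\<in>V. f (s c x) = s c (f x))"

locale dga =
  fixes A :: "('k::real_normed_field, 'a::ab_group_add) dga_data"
  assumes vector_space: "vector_space (scal A)"
    and subspace_forms: "module.subspace (scal A) (forms A n)"
    and forms_neg: "n < 0 \<Longrightarrow> forms A n = {0}"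
    and dif_linear: "lin_map (scal A) (forms A n) (forms A (n + 1)) (dif A n)"
    and wedge_linear_left:
      "y \<in> forms A m \<Longrightarrow> lin_map (scal A) (forms A n) (forms A (n + m)) (\<lambda>x. wedge A n m x y)"
    and wedge_linear_right:
      "x \<in> forms A n \<Longrightarrow> lin_map (scal A) (forms A m) (forms A (n + m)) (\<lambda>y. wedge A n m x y)"
    and wedge_assoc:
      "x \<in> forms A n \<Longrightarrow> y \<in> forms A m \<Longrightarrow> z \<in> forms A p \<Longrightarrow>
        wedge A (n + m) p (wedge A n m x y) z = wedge A n (m + p) x (wedge A m p y z)"
    and unit_form: "unit_form A \<in> forms A 0"
    and wedge_unit_left: "x \<in> forms A n \<Longrightarrow> wedge A 0 n (unit_form A) x = x"
    and wedge_unit_right: "x \<in> forms A n \<Longrightarrow> wedge A n 0 x (unit_form A) = x"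
    and dif_dif: "x \<in> forms A n \<Longrightarrow> dif A (n + 1) (dif A n x) = 0"
    and dif_wedge:
      "x \<in> forms A n \<Longrightarrow> y \<in> forms A m \<Longrightarrow>
        dif A (n + m) (wedge A n m x y) =
          wedge A (n + 1) m (dif A n x) y
          + scal A ((-1) powi n) (wedge A n (m + 1) x (dif A m y))"


section \<open>Tensor products over the degree \<open>0\<close> algebra and covariant derivatives\<close>

text \<open>
  The tensor product \<open>A\<^sup>p \<otimes> A\<^sup>q\<close> over the algebra \<open>A\<^sup>0\<close> is the free abelian group on \<open>A\<^sup>p \<times> A\<^sup>q\<close>
  modulo biadditivity and the balancing relation. Since \<open>A\<^sup>0\<close> contains the ground field (as
  multiples of the unit), balancing includes bilinearity over the field.
\<close>

abbreviation tensor_free ::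
  "('k, 'a) dga_data \<Rightarrow> int \<Rightarrow> int \<Rightarrow> ('a \<times> 'a \<Rightarrow>\<^sub>0 int) monoid" where
  "tensor_free A p q \<equiv> free_Abelian_group (forms A p \<times> forms A q)"

definition tensor_rels ::
  "('k, 'a::ab_group_add) dga_data \<Rightarrow> int \<Rightarrow> int \<Rightarrow> ('a \<times> 'a \<Rightarrow>\<^sub>0 int) set" where
  "tensor_rels A p q = generate (tensor_free A p q)
     ({frag_of (x + x', y) - frag_of (x, y) - frag_of (x', y) | x x' y.
         x \<in> forms A p \<and> x' \<in> forms A p \<and> y \<in> forms A q} \<union>
      {frag_of (x, y + y') - frag_of (x, y) - frag_of (x, y') | x y y'.
         x \<in> forms A p \<and> y \<in> forms A q \<and> y' \<in> forms A q} \<union>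
      {frag_of (wedge A p 0 x f, y) - frag_of (x, wedge A 0 q f y) | x f y.
         x \<in> forms A p \<and> f \<in> forms A 0 \<and> y \<in> forms A q})"

definition tensor_prod ::
  "('k, 'a::ab_group_add) dga_data \<Rightarrow> int \<Rightarrow> int \<Rightarrow> ('a \<times> 'a \<Rightarrow>\<^sub>0 int) set monoid" where
  "tensor_prod A p q = tensor_free A p q Mod tensor_rels A p q"

definition tensor_class ::
  "('k, 'a::ab_group_add) dga_data \<Rightarrow> int \<Rightarrow> int \<Rightarrow> ('a \<times> 'a \<Rightarrow>\<^sub>0 int) \<Rightarrow> ('a \<times> 'a \<Rightarrow>\<^sub>0 int) set" where
  "tensor_class A p q z = tensor_rels A p q #>\<^bsub>tensor_free A p q\<^esub> z"

definition tensor ::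
  "('k, 'a::ab_group_add) dga_data \<Rightarrow> int \<Rightarrow> int \<Rightarrow> 'a \<Rightarrow> 'a \<Rightarrow> ('a \<times> 'a \<Rightarrow>\<^sub>0 int) set" where
  "tensor A p q x y = tensor_class A p q (frag_of (x, y))"

text \<open>
  For an additive map \<open>\<phi>\<close> commuting with the right action of \<open>A\<^sup>0\<close>, the induced map
  \<open>x \<otimes> y \<mapsto> \<phi> x \<otimes> y\<close>. The image of a coset is only contained in a coset, hence the extra factor.
\<close>

definition tensor_act_left ::
  "('k, 'a::ab_group_add) dga_data \<Rightarrow> int \<Rightarrow> int \<Rightarrow> ('a \<Rightarrow> 'a) \<Rightarrow>
    ('a \<times> 'a \<Rightarrow>\<^sub>0 int) set \<Rightarrow> ('a \<times> 'a \<Rightarrow>\<^sub>0 int) set" where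
  "tensor_act_left A p q \<phi> X =
     tensor_rels A p q <#>\<^bsub>tensor_free A p q\<^esub> frag_extend (\<lambda>(x, y). frag_of (\<phi> x, y)) ` X"

definition tensor_scale ::
  "('k, 'a::ab_group_add) dga_data \<Rightarrow> int \<Rightarrow> int \<Rightarrow> 'k \<Rightarrow>
    ('a \<times> 'a \<Rightarrow>\<^sub>0 int) set \<Rightarrow> ('a \<times> 'a \<Rightarrow>\<^sub>0 int) set" where
  "tensor_scale A p q c = tensor_act_left A p q (scal A c)"

definition tensor_lmult ::
  "('k, 'a::ab_group_add) dga_data \<Rightarrow> int \<Rightarrow> int \<Rightarrow> 'a \<Rightarrow>
    ('a \<times> 'a \<Rightarrow>\<^sub>0 int) set \<Rightarrow> ('a \<times> 'a \<Rightarrow>\<^sub>0 int) set" where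
  "tensor_lmult A p q f = tensor_act_left A p q (wedge A 0 p f)"

definition left_covariant_derivative ::
  "('k, 'a::ab_group_add) dga_data \<Rightarrow> int \<Rightarrow> ('a \<Rightarrow> ('a \<times> 'a \<Rightarrow>\<^sub>0 int) set) \<Rightarrow> bool" where
  "left_covariant_derivative A n N \<longleftrightarrow>
     N \<in> forms A n \<rightarrow> carrier (tensor_prod A 1 n) \<and>
     (\<forall>x\<in>forms A n. \<forall>y\<in>forms A n. N (x + y) = N x \<otimes>\<^bsub>tensor_prod A 1 n\<^esub> N y) \<and>
     (\<forall>c. \<forall>x\<in>forms A n. N (scal A c x) = tensor_scale A 1 n c (N x)) \<and>
     (\<forall>f\<in>forms A 0. \<forall>x\<in>forms A n.
        N (wedge A 0 n f x) =
          tensor A 1 n (dif A 0 f) x \<otimes>\<^bsub>tensor_prod A 1 n\<^esub> tensor_lmult A 1 n f (N x))"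

definition is_tensor_map ::
  "('k, 'a::ab_group_add) dga_data \<Rightarrow> ('k, 'b::ab_group_add) dga_data \<Rightarrow> int \<Rightarrow> int \<Rightarrow>
    ('a \<Rightarrow> 'b) \<Rightarrow> ('a \<Rightarrow> 'b) \<Rightarrow>
    (('a \<times> 'a \<Rightarrow>\<^sub>0 int) set \<Rightarrow> ('b \<times> 'b \<Rightarrow>\<^sub>0 int) set) \<Rightarrow> bool" where
  "is_tensor_map A B p q \<phi> \<psi> T \<longleftrightarrow>
     T \<in> hom (tensor_prod A p q) (tensor_prod B p q) \<and>
     (\<forall>c. \<forall>X\<in>carrier (tensor_prod A p q).
        T (tensor_scale A p q c X) = tensor_scale B p q c (T X)) \<and>
     (\<forall>x\<in>forms A p. \<forall>y\<in>forms A q. T (tensor A p q x y) = tensor B p q (\<phi> x) (\<psi> y))"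


section \<open>Forms depending smoothly on time\<close>

definition smooth_fun :: "(real \<Rightarrow> 'k::real_normed_vector) \<Rightarrow> bool" where
  "smooth_fun f \<longleftrightarrow>
     (\<forall>n t. ((\<lambda>g s. vector_derivative g (at s)) ^^ n) f differentiable (at t))"

text \<open>
  The tensor product \<open>V \<otimes> C\<^sup>\<infinity>(\<real>)\<close> over the ground field, realised (faithfully) as a space of
  functions of \<open>t\<close>: the finite sum of the \<open>v\<^sub>i \<otimes> f\<^sub>i\<close> is the function sending \<open>t\<close> to the sum of
  the \<open>f\<^sub>i(t) v\<^sub>i\<close>.
\<close>

definition tensor_smooth ::
  "('k::real_normed_field \<Rightarrow> 'a \<Rightarrow> 'a::ab_group_add) \<Rightarrow> 'a set \<Rightarrow> (real \<Rightarrow> 'a) set" where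
  "tensor_smooth s V =
     {(\<lambda>t. \<Sum>i<N. s (f i t) (v i)) | (N::nat) f v. \<forall>i<N. smooth_fun (f i) \<and> v i \<in> V}"

definition time_deriv ::
  "('k::real_normed_field \<Rightarrow> 'a \<Rightarrow> 'a::ab_group_add) \<Rightarrow> (real \<Rightarrow> 'a) \<Rightarrow> real \<Rightarrow> 'a" where
  "time_deriv s \<xi> = (THE \<eta>. \<exists>(N::nat) f v.
     (\<forall>i<N. smooth_fun (f i)) \<and>
     \<xi> = (\<lambda>t. \<Sum>i<N. s (f i t) (v i)) \<and>
     \<eta> = (\<lambda>t. \<Sum>i<N. s (vector_derivative (f i) (at t)) (v i)))"

text \<open>The description in \<^const>\<open>time_deriv\<close> is proper: \<open>\<eta>\<close> does not depend on the representation of \<open>\<xi>\<close>.\<close>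

lemma time_deriv_sum:
  fixes s :: "'k::real_normed_field \<Rightarrow> 'a \<Rightarrow> 'a::ab_group_add" and N :: nat
  assumes s: "vector_space s" and f: "\<And>i. i < N \<Longrightarrow> smooth_fun (f i)"
  shows "time_deriv s (\<lambda>t. \<Sum>i<N. s (f i t) (v i)) =
           (\<lambda>t. \<Sum>i<N. s (vector_derivative (f i) (at t)) (v i))"
proof -
  interpret vector_space s by (fact s)
  obtain B where B: "independent B" "span B = UNIV"
    using maximal_independent_subset[of UNIV] by (metis top.extremum_uniqueI)
  have rep: "representation B (\<Sum>i<K. s (c i) (u i)) b = (\<Sum>i<K. c i * representation B (u i) b)"
    for K :: nat and c u b
    using B by (simp add: representation_sum representation_scale)
  have inj: "x = y" if "\<And>b. representation B x b = representation B y b" for x y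
  proof -
    have "representation B x = representation B y"
      using that by (rule ext)
    then show ?thesis
      using sum_nonzero_representation_eq[OF B(1)] B(2) by (metis UNIV_I)
  qed
  have diff: "f differentiable (at t)" if "smooth_fun f" for f :: "real \<Rightarrow> 'k" and t
    using that[unfolded smooth_fun_def, rule_format, of 0 t] by simp
  have deriv: "((\<lambda>t. \<Sum>i<K. f i t * r i) has_vector_derivative
      (\<Sum>i<K. vector_derivative (f i) (at t) * r i)) (at t)"
    if "\<And>i. i < K \<Longrightarrow> smooth_fun (f i)" for K :: nat and f :: "nat \<Rightarrow> real \<Rightarrow> 'k" and r t
    using that diff
    by (intro has_vector_derivative_sum has_vector_derivative_mult_left)
      (simp add: vector_derivative_works)
  have unique: "(\<Sum>i<M. s (vector_derivative (g i) (at t)) (w i)) =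
      (\<Sum>i<N. s (vector_derivative (f i) (at t)) (v i))"
    if g: "\<And>i. i < M \<Longrightarrow> smooth_fun (g i)"
      and eq: "\<And>t. (\<Sum>i<N. s (f i t) (v i)) = (\<Sum>i<M. s (g i t) (w i))"
    for M :: nat and g w t
  proof (rule inj)
    fix b
    have "(\<lambda>t. \<Sum>i<N. f i t * representation B (v i) b) =
        (\<lambda>t. \<Sum>i<M. g i t * representation B (w i) b)"
      unfolding rep[symmetric] eq ..
    then show "representation B (\<Sum>i<M. s (vector_derivative (g i) (at t)) (w i)) b =
        representation B (\<Sum>i<N. s (vector_derivative (f i) (at t)) (v i)) b"
      unfolding rep
      using deriv[of N f "\<lambda>i. representation B (v i) b" t, OF f]
        deriv[of M g "\<lambda>i. representation B (w i) b" t, OF g]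
      by (simp add: vector_derivative_unique_at)
  qed
  show ?thesis
    unfolding time_deriv_def
  proof (rule the_equality)
    show "\<exists>(M::nat) g w. (\<forall>i<M. smooth_fun (g i)) \<and>
        (\<lambda>t. \<Sum>i<N. s (f i t) (v i)) = (\<lambda>t. \<Sum>i<M. s (g i t) (w i)) \<and>
        (\<lambda>t. \<Sum>i<N. s (vector_derivative (f i) (at t)) (v i)) =
          (\<lambda>t. \<Sum>i<M. s (vector_derivative (g i) (at t)) (w i))"
      using f by (intro exI[of _ N] exI[of _ f] exI[of _ v]) simp
  next
    fix \<eta>
    assume "\<exists>(M::nat) g w. (\<forall>i<M. smooth_fun (g i)) \<and>
        (\<lambda>t. \<Sum>i<N. s (f i t) (v i)) = (\<lambda>t. \<Sum>i<M. s (g i t) (w i)) \<and>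
        \<eta> = (\<lambda>t. \<Sum>i<M. s (vector_derivative (g i) (at t)) (w i))"
    then obtain M :: nat and g w where g: "\<And>i. i < M \<Longrightarrow> smooth_fun (g i)"
      and eq: "(\<lambda>t. \<Sum>i<N. s (f i t) (v i)) = (\<lambda>t. \<Sum>i<M. s (g i t) (w i))"
      and \<eta>: "\<eta> = (\<lambda>t. \<Sum>i<M. s (vector_derivative (g i) (at t)) (w i))"
      by blast
    show "\<eta> = (\<lambda>t. \<Sum>i<N. s (vector_derivative (f i) (at t)) (v i))"
      unfolding \<eta> by (rule ext, rule unique[OF g fun_cong[OF eq]])
  qed
qed


section \<open>The deformed calculus on \<open>F\<^sub>\<real>\<close>\<close>

text \<open>
  A form \<open>\<xi> + \<xi>' \<and> dt\<close> of degree \<open>n\<close> on \<open>F\<^sub>\<real>\<close> is the pair \<open>(\<xi>, \<xi>')\<close>, where \<open>\<xi>\<close> has degree \<open>n\<close>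
  and \<open>\<xi>'\<close> has degree \<open>n - 1\<close>. The given maps \<open>\<delta>\<close> are indexed by the degree of their argument.
\<close>

definition laplacian ::
  "('k, 'a::ab_group_add) dga_data \<Rightarrow> (int \<Rightarrow> 'a \<Rightarrow> 'a) \<Rightarrow> int \<Rightarrow> 'a \<Rightarrow> 'a" where
  "laplacian A \<delta> n x = \<delta> (n + 1) (dif A n x) + dif A (n - 1) (\<delta> n x)"

definition deformed_dif ::
  "('k::real_normed_field, 'a::ab_group_add) dga_data \<Rightarrow> (int \<Rightarrow> 'a \<Rightarrow> 'a) \<Rightarrow> real \<Rightarrow>
    int \<Rightarrow> (real \<Rightarrow> 'a) \<times> (real \<Rightarrow> 'a) \<Rightarrow> (real \<Rightarrow> 'a) \<times> (real \<Rightarrow> 'a)" where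
  "deformed_dif A \<delta> \<alpha> n = (\<lambda>(\<xi>, \<xi>').
     (\<lambda>t. dif A n (\<xi> t),
      \<lambda>t. scal A ((-1) powi n) (time_deriv (scal A) \<xi> t)
         + scal A ((-1) powi n * of_real \<alpha>) (laplacian A \<delta> n (\<xi> t))
         + dif A (n - 1) (\<xi>' t)))"

definition deformed_wedge ::
  "('k::real_normed_field, 'a::ab_group_add) dga_data \<Rightarrow> (int \<Rightarrow> 'a \<Rightarrow> 'a) \<Rightarrow> real \<Rightarrow>
    int \<Rightarrow> int \<Rightarrow> (real \<Rightarrow> 'a) \<times> (real \<Rightarrow> 'a) \<Rightarrow> (real \<Rightarrow> 'a) \<times> (real \<Rightarrow> 'a) \<Rightarrow>
    (real \<Rightarrow> 'a) \<times> (real \<Rightarrow> 'a)" where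
  "deformed_wedge A \<delta> \<alpha> n m = (\<lambda>(\<xi>, \<xi>') (\<eta>, \<eta>').
     (\<lambda>t. wedge A n m (\<xi> t) (\<eta> t),
      \<lambda>t. - scal A ((-1) powi (n + m) * of_real \<alpha>)
              (\<delta> (n + m) (wedge A n m (\<xi> t) (\<eta> t))
               - wedge A (n - 1) m (\<delta> n (\<xi> t)) (\<eta> t)
               - scal A ((-1) powi n) (wedge A n (m - 1) (\<xi> t) (\<delta> m (\<eta> t))))
         + scal A ((-1) powi m) (wedge A (n - 1) m (\<xi>' t) (\<eta> t))
         + wedge A n (m - 1) (\<xi> t) (\<eta>' t)))"

definition deformed ::
  "('k::real_normed_field, 'a::ab_group_add) dga_data \<Rightarrow> (int \<Rightarrow> 'a \<Rightarrow> 'a) \<Rightarrow> real \<Rightarrow>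
    ('k, (real \<Rightarrow> 'a) \<times> (real \<Rightarrow> 'a)) dga_data" where
  "deformed A \<delta> \<alpha> = \<lparr>
     scal = (\<lambda>c (\<xi>, \<xi>'). (\<lambda>t. scal A c (\<xi> t), \<lambda>t. scal A c (\<xi>' t))),
     forms = (\<lambda>n. tensor_smooth (scal A) (forms A n) \<times> tensor_smooth (scal A) (forms A (n - 1))),
     dif = deformed_dif A \<delta> \<alpha>,
     wedge = deformed_wedge A \<delta> \<alpha>,
     unit_form = (\<lambda>t. unit_form A, \<lambda>t. 0) \<rparr>"

definition deform_iso ::
  "('k::real_normed_field, 'a::ab_group_add) dga_data \<Rightarrow> (int \<Rightarrow> 'a \<Rightarrow> 'a) \<Rightarrow> real \<Rightarrow>
    int \<Rightarrow> (real \<Rightarrow> 'a) \<times> (real \<Rightarrow> 'a) \<Rightarrow> (real \<Rightarrow> 'a) \<times> (real \<Rightarrow> 'a)" where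
  "deform_iso A \<delta> \<alpha> n = (\<lambda>(\<xi>, \<xi>').
     (\<xi>, \<lambda>t. \<xi>' t - scal A ((-1) powi n * of_real \<alpha>) (\<delta> n (\<xi> t))))"

definition dt_form :: "('k, 'a::zero) dga_data \<Rightarrow> (real \<Rightarrow> 'a) \<times> (real \<Rightarrow> 'a)" where
  "dt_form A = (\<lambda>t. 0, \<lambda>t. unit_form A)"

text \<open>
  \<open>X \<in> F\<^sub>\<real>\<^sup>p \<otimes>\<^sub>0 F\<^sub>\<real>\<^sup>q\<close> is the element whose value at each time \<open>t\<close> is \<open>Y t \<in> F\<^sup>p \<otimes> F\<^sup>q\<close>: it
  is represented by a formal sum of pairs of forms without \<open>dt\<close> component, and evaluating those
  forms at \<open>t\<close> gives a representative of \<open>Y t\<close>.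
\<close>

definition pointwise_tensor ::
  "('k::real_normed_field, 'a::ab_group_add) dga_data \<Rightarrow> (int \<Rightarrow> 'a \<Rightarrow> 'a) \<Rightarrow> int \<Rightarrow> int \<Rightarrow>
    (((real \<Rightarrow> 'a) \<times> (real \<Rightarrow> 'a)) \<times> ((real \<Rightarrow> 'a) \<times> (real \<Rightarrow> 'a)) \<Rightarrow>\<^sub>0 int) set \<Rightarrow>
    (real \<Rightarrow> ('a \<times> 'a \<Rightarrow>\<^sub>0 int) set) \<Rightarrow> bool" where
  "pointwise_tensor A \<delta> p q X Y \<longleftrightarrow>
     (\<exists>z. Poly_Mapping.keys z \<subseteq>
            (tensor_smooth (scal A) (forms A p) \<times> {\<lambda>t. 0}) \<times>
            (tensor_smooth (scal A) (forms A q) \<times> {\<lambda>t. 0}) \<and>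
          X = tensor_class (deformed A \<delta> 0) p q z \<and>
          (\<forall>t. Y t = tensor_class A p q (frag_extend (\<lambda>((a, _), (b, _)). frag_of (a t, b t)) z)))"

text \<open>
  \<open>N\<^sub>0\<close> is obtained from \<open>N\<close> by adding time: \<open>N\<^sub>0(\<xi>) = N(\<xi>) + dt \<otimes> \<partial>\<xi>/\<partial>t\<close> for \<open>\<xi>\<close> without \<open>dt\<close>
  component, where \<open>N(\<xi>)(t) = N(\<xi>(t))\<close>. This does not determine \<open>N\<^sub>0\<close> on forms \<open>\<xi>' \<and> dt\<close>.
\<close>

definition adds_time ::
  "('k::real_normed_field, 'a::ab_group_add) dga_data \<Rightarrow> (int \<Rightarrow> 'a \<Rightarrow> 'a) \<Rightarrow> int \<Rightarrow>
    ('a \<Rightarrow> ('a \<times> 'a \<Rightarrow>\<^sub>0 int) set) \<Rightarrow>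
    ((real \<Rightarrow> 'a) \<times> (real \<Rightarrow> 'a) \<Rightarrow>
      (((real \<Rightarrow> 'a) \<times> (real \<Rightarrow> 'a)) \<times> ((real \<Rightarrow> 'a) \<times> (real \<Rightarrow> 'a)) \<Rightarrow>\<^sub>0 int) set) \<Rightarrow> bool" where
  "adds_time A \<delta> n N N0 \<longleftrightarrow>
     (\<forall>\<xi>\<in>tensor_smooth (scal A) (forms A n).
        \<exists>X. pointwise_tensor A \<delta> 1 n X (\<lambda>t. N (\<xi> t)) \<and>
            N0 (\<xi>, \<lambda>t. 0) =
              X \<otimes>\<^bsub>tensor_prod (deformed A \<delta> 0) 1 n\<^esub>
              tensor (deformed A \<delta> 0) 1 n (dt_form A) (time_deriv (scal A) \<xi>, \<lambda>t. 0))"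

end

theory Submission
  imports Defs
begin

text \<open>
  The deformed calculus is the undeformed one seen through \<open>\<I>\<close>: deforming is a change of
  coordinates \<open>\<xi>' \<mapsto> \<xi>' - (-1)\<^sup>n \<alpha> \<delta>\<xi>\<close> in the \<open>dt\<close> component, with inverse the same map for \<open>- \<alpha>\<close>, and the
  correction terms in \<open>d\<^sub>\<alpha>\<close> and \<open>\<and>\<^sub>\<alpha>\<close> are exactly what makes \<open>\<I>\<close> commute with the differentials and the
  products (\<open>graded_iso_deform\<close>). A left covariant derivative is defined by the algebra operations
  alone, so it can be carried along any isomorphism, and the Leibniz rule for \<open>\<nabla>\<^sub>\<alpha>\<close> is the one for \<open>\<nabla>\<^sub>0\<close>
  with every operation replaced by its image (\<open>left_covariant_derivative_transport\<close>).

  For the induced map of tensor products, apply \<open>\<phi> \<otimes> \<phi>\<close> to formal sums of pairs. For an isomorphism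
  \<open>\<phi>\<close> this carries the relations of one tensor product \<^emph>\<open>onto\<close> those of the other
  (\<open>tensor_rels_image\<close>), because it does so for the generating relations. Hence the direct image of a
  coset is again a coset, not merely part of one, so \<open>\<I> \<otimes> \<I>\<close> is simply the direct image of sets of
  formal sums. Well-definedness is then automatic, and compatibility with sums, scalars and the left
  action needs no choice of representatives. Uniqueness holds since the \<open>x \<otimes> y\<close> generate the tensor
  product.

  The analytic content is confined to closure: the product, the differential, \<open>\<delta>\<close> and \<open>\<partial>/\<partial>t\<close>, taken
  pointwise in \<open>t\<close>, do not leave the spaces \<open>F\<^sup>n \<otimes> C\<^sup>\<infinity>(\<real>)\<close>; the product needs that smooth functions are
  closed under multiplication.
\<close>

section \<open>Transport of covariant derivatives along an isomorphism\<close>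

text \<open>
  The generating relations, named apart from the subgroup \<^const>\<open>tensor_rels\<close> they generate, so that
  images and membership in the carrier can be checked on them alone.
\<close>

definition tensor_gens ::
  "('k, 'a::ab_group_add) dga_data \<Rightarrow> int \<Rightarrow> int \<Rightarrow> ('a \<times> 'a \<Rightarrow>\<^sub>0 int) set" where
  "tensor_gens A p q =
     {frag_of (x + x', y) - frag_of (x, y) - frag_of (x', y) | x x' y.
         x \<in> forms A p \<and> x' \<in> forms A p \<and> y \<in> forms A q} \<union>
     {frag_of (x, y + y') - frag_of (x, y) - frag_of (x, y') | x y y'.
         x \<in> forms A p \<and> y \<in> forms A q \<and> y' \<in> forms A q} \<union>
     {frag_of (wedge A p 0 x f, y) - frag_of (x, wedge A 0 q f y) | x f y.
         x \<in> forms A p \<and> f \<in> forms A 0 \<and> y \<in> forms A q}"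

lemma tensor_rels_generate: "tensor_rels A p q = generate (tensor_free A p q) (tensor_gens A p q)"
  unfolding tensor_rels_def tensor_gens_def ..

lemma carrier_tensor_prod:
  "carrier (tensor_prod A p q) = tensor_class A p q ` carrier (tensor_free A p q)"
  by (auto simp: tensor_prod_def tensor_class_def FactGroup_def RCOSETS_def)

lemma tensor_prod_normal:
  assumes "tensor_gens A p q \<subseteq> carrier (tensor_free A p q)"
  shows "tensor_rels A p q \<lhd> tensor_free A p q"
proof -
  interpret comm_group "tensor_free A p q"
    by (rule abelian_free_Abelian_group)
  show ?thesis
    unfolding normal_iff_subgroup tensor_rels_generate
    by (rule generate_is_subgroup[OF assms])
qed

text \<open>
  Precomposed with the projection, both maps are homomorphisms on a free abelian group, where they
  are determined by the basis. The projection is a homomorphism only because the relations form a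
  subgroup, which is what the first hypothesis provides.
\<close>

lemma tensor_prod_hom_eqI:
  assumes gens: "tensor_gens A p q \<subseteq> carrier (tensor_free A p q)"
    and H: "group H"
    and S: "S \<in> hom (tensor_prod A p q) H" and T: "T \<in> hom (tensor_prod A p q) H"
    and eq: "\<And>x y. x \<in> forms A p \<Longrightarrow> y \<in> forms A q \<Longrightarrow>
      S (tensor A p q x y) = T (tensor A p q x y)"
    and X: "X \<in> carrier (tensor_prod A p q)"
  shows "S X = T X"
proof -
  let ?G = "tensor_free A p q"
  interpret nrm: normal "tensor_rels A p q" ?G
    by (rule tensor_prod_normal[OF gens])
  have cls: "tensor_class A p q \<in> hom ?G (tensor_prod A p q)"
    using nrm.r_coset_hom_Mod unfolding tensor_prod_def tensor_class_def .
  interpret SC: group_hom ?G H "S \<circ> tensor_class A p q"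
    using H S hom_compose[OF cls S]
    by (intro group_hom.intro) (auto simp: group_hom_axioms_def nrm.is_group)
  interpret TC: group_hom ?G H "T \<circ> tensor_class A p q"
    using H T hom_compose[OF cls T]
    by (intro group_hom.intro) (auto simp: group_hom_axioms_def nrm.is_group)
  obtain z where z: "z \<in> carrier ?G" and Xz: "X = tensor_class A p q z"
    using X unfolding carrier_tensor_prod by auto
  have "Poly_Mapping.keys z \<subseteq> forms A p \<times> forms A q"
    using z by simp
  then have "z \<in> carrier ?G \<and> (S \<circ> tensor_class A p q) z = (T \<circ> tensor_class A p q) z"
  proof (induction z rule: frag_induction)
    case zero
    then show ?case
      using SC.hom_one TC.hom_one nrm.one_closed by simp
  next
    case (one u)
    then show ?case
      using eq by (cases u) (auto simp: tensor_def)
  next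
    case (diff a b)
    have ab: "a - b = a \<otimes>\<^bsub>?G\<^esub> inv\<^bsub>?G\<^esub> b"
      using diff by simp
    show ?case
      unfolding ab using diff
      by (metis SC.hom_mult SC.hom_inv TC.hom_mult TC.hom_inv nrm.inv_closed nrm.m_closed)
  qed
  then show ?thesis
    by (simp add: Xz)
qed

text \<open>
  Closure is stated for \<open>A\<close> only: since each \<open>\<phi> n\<close> is bijective, it carries over to \<open>B\<close>.
\<close>

locale graded_iso =
  fixes A :: "('k, 'a::ab_group_add) dga_data" and B :: "('k, 'b::ab_group_add) dga_data"
    and \<phi> :: "int \<Rightarrow> 'a \<Rightarrow> 'b"
  assumes add_closed: "x \<in> forms A n \<Longrightarrow> x' \<in> forms A n \<Longrightarrow> x + x' \<in> forms A n"
    and scal_closed: "x \<in> forms A n \<Longrightarrow> scal A c x \<in> forms A n"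
    and wedge_closed: "x \<in> forms A n \<Longrightarrow> y \<in> forms A m \<Longrightarrow> wedge A n m x y \<in> forms A (n + m)"
    and dif_closed: "x \<in> forms A n \<Longrightarrow> dif A n x \<in> forms A (n + 1)"
    and bij: "bij_betw (\<phi> n) (forms A n) (forms B n)"
    and map_add: "x \<in> forms A n \<Longrightarrow> x' \<in> forms A n \<Longrightarrow> \<phi> n (x + x') = \<phi> n x + \<phi> n x'"
    and map_scal: "x \<in> forms A n \<Longrightarrow> \<phi> n (scal A c x) = scal B c (\<phi> n x)"
    and map_wedge: "x \<in> forms A n \<Longrightarrow> y \<in> forms A m \<Longrightarrow>
      \<phi> (n + m) (wedge A n m x y) = wedge B n m (\<phi> n x) (\<phi> m y)"
    and map_dif: "x \<in> forms A n \<Longrightarrow> \<phi> (n + 1) (dif A n x) = dif B n (\<phi> n x)"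
begin

lemma image_forms: "\<phi> n ` forms A n = forms B n"
  using bij by (simp add: bij_betw_def)

lemma map_forms: "x \<in> forms A n \<Longrightarrow> \<phi> n x \<in> forms B n"
  using image_forms by auto

lemma inv_map: "x \<in> forms A n \<Longrightarrow> inv_into (forms A n) (\<phi> n) (\<phi> n x) = x"
  by (rule bij_betw_inv_into_left[OF bij])

definition map_frag :: "int \<Rightarrow> int \<Rightarrow> ('a \<times> 'a \<Rightarrow>\<^sub>0 int) \<Rightarrow> ('b \<times> 'b \<Rightarrow>\<^sub>0 int)" where
  "map_frag p q = frag_extend (\<lambda>(x, y). frag_of (\<phi> p x, \<phi> q y))"

lemma map_frag_of [simp]: "map_frag p q (frag_of (x, y)) = frag_of (\<phi> p x, \<phi> q y)"
  by (simp add: map_frag_def)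

lemma map_frag_add: "map_frag p q (z + w) = map_frag p q z + map_frag p q w"
  by (simp add: map_frag_def frag_extend_add)

lemma map_frag_diff: "map_frag p q (z - w) = map_frag p q z - map_frag p q w"
  by (simp add: map_frag_def frag_extend_diff)

lemma map_frag_carrier:
  "z \<in> carrier (tensor_free A p q) \<Longrightarrow> map_frag p q z \<in> carrier (tensor_free B p q)"
  unfolding map_frag_def
  using keys_frag_extend[of "\<lambda>(x, y). frag_of (\<phi> p x, \<phi> q y)" z]
  by (fastforce dest: map_forms split: prod.splits)

lemma group_hom_map_frag:
  "group_hom (tensor_free A p q) (tensor_free B p q) (map_frag p q)"
  by (intro group_hom.intro)
    (auto simp: group_hom_axioms_def hom_def map_frag_add intro: map_frag_carrier
      simp del: carrier_free_Abelian_group_iff)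

lemma tensor_gens_carrier: "tensor_gens A p q \<subseteq> carrier (tensor_free A p q)"
proof -
  have diff: "z - w \<in> carrier (tensor_free A p q)"
    if "z \<in> carrier (tensor_free A p q)" "w \<in> carrier (tensor_free A p q)" for z w
    using that keys_diff[of z w] by auto
  show ?thesis
    unfolding tensor_gens_def
    using wedge_closed[of _ p _ 0] wedge_closed[of _ 0 _ q]
    by (auto intro!: diff simp: add_closed simp del: carrier_free_Abelian_group_iff)
qed

text \<open>
  Surjectivity of \<open>\<phi>\<close> is essential here: a generating relation of \<open>B\<close> involves arbitrary forms of
  \<open>B\<close>, and each has to come from a form of \<open>A\<close>. The balancing relation also uses \<open>\<phi> 0\<close>, multiplicative
  against degrees \<open>p\<close> and \<open>q\<close>.
\<close>

lemma tensor_gens_image: "tensor_gens B p q = map_frag p q ` tensor_gens A p q"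
proof -
  have wp: "wedge B p 0 (\<phi> p x) (\<phi> 0 f) = \<phi> p (wedge A p 0 x f)"
    if "x \<in> forms A p" "f \<in> forms A 0" for x f
    using map_wedge[of x p f 0] that by simp
  have wq: "wedge B 0 q (\<phi> 0 f) (\<phi> q y) = \<phi> q (wedge A 0 q f y)"
    if "y \<in> forms A q" "f \<in> forms A 0" for y f
    using map_wedge[of f 0 y q] that by simp
  have UN: "{h x y z | x y z. x \<in> P \<and> y \<in> Q \<and> z \<in> R} = (\<Union>x\<in>P. \<Union>y\<in>Q. \<Union>z\<in>R. {h x y z})"
    for h :: "'c \<Rightarrow> 'c \<Rightarrow> 'c \<Rightarrow> 'd" and P Q R
    by blast
  show ?thesis
    unfolding tensor_gens_def UN image_Un image_UN image_forms[symmetric]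
    by (simp add: map_frag_diff map_add wp wq cong: SUP_cong)
qed

lemma tensor_rels_image: "tensor_rels B p q = map_frag p q ` tensor_rels A p q"
  unfolding tensor_rels_generate tensor_gens_image
  by (rule group_hom.generate_img[OF group_hom_map_frag tensor_gens_carrier])

lemma tensor_gens_carrier_target: "tensor_gens B p q \<subseteq> carrier (tensor_free B p q)"
  unfolding tensor_gens_image using tensor_gens_carrier map_frag_carrier by blast

text \<open>
  The direct image is the induced map \<open>\<phi> \<otimes> \<phi>\<close> because cosets go to whole cosets, by
  \<open>tensor_rels_image\<close>; for a general homomorphism the relations of \<open>B\<close> would have to be added.
\<close>

definition map_tensor ::
  "int \<Rightarrow> int \<Rightarrow> ('a \<times> 'a \<Rightarrow>\<^sub>0 int) set \<Rightarrow> ('b \<times> 'b \<Rightarrow>\<^sub>0 int) set" where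
  "map_tensor p q X = map_frag p q ` X"

lemma map_tensor_set_mult:
  "map_tensor p q (X <#>\<^bsub>tensor_free A p q\<^esub> Y) =
     map_tensor p q X <#>\<^bsub>tensor_free B p q\<^esub> map_tensor p q Y"
  by (force simp: map_tensor_def set_mult_def map_frag_add)

lemma map_tensor_mult:
  "map_tensor p q (X \<otimes>\<^bsub>tensor_prod A p q\<^esub> Y) =
     map_tensor p q X \<otimes>\<^bsub>tensor_prod B p q\<^esub> map_tensor p q Y"
  by (simp add: tensor_prod_def map_tensor_set_mult)

lemma map_tensor_class:
  "map_tensor p q (tensor_class A p q z) = tensor_class B p q (map_frag p q z)"
  by (force simp: map_tensor_def tensor_class_def r_coset_def tensor_rels_image map_frag_add)

lemma map_tensor_tensor:
  "map_tensor p q (tensor A p q x y) = tensor B p q (\<phi> p x) (\<phi> q y)"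
  by (simp add: tensor_def map_tensor_class)

lemma map_tensor_carrier:
  "X \<in> carrier (tensor_prod A p q) \<Longrightarrow> map_tensor p q X \<in> carrier (tensor_prod B p q)"
  unfolding carrier_tensor_prod
  by (auto simp: map_tensor_class intro!: imageI map_frag_carrier
      simp del: carrier_free_Abelian_group_iff)

lemma tensor_carrier_subset:
  assumes "X \<in> carrier (tensor_prod A p q)"
  shows "X \<subseteq> carrier (tensor_free A p q)"
proof -
  interpret normal "tensor_rels A p q" "tensor_free A p q"
    by (rule tensor_prod_normal[OF tensor_gens_carrier])
  show ?thesis
    using assms rcosets_carrier unfolding tensor_prod_def FactGroup_def by simp
qed

text \<open>
  Both actions are set products of the relations with a direct image. The map on formal sums takes
  relations onto relations and intertwines \<open>h\<close> with \<open>k\<close>, so taking direct images does the same.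
\<close>

lemma map_tensor_act_left:
  assumes X: "X \<in> carrier (tensor_prod A p q)"
    and h: "\<And>x. x \<in> forms A p \<Longrightarrow> \<phi> p (h x) = k (\<phi> p x)"
  shows "map_tensor p q (tensor_act_left A p q h X) = tensor_act_left B p q k (map_tensor p q X)"
proof -
  let ?h = "frag_extend (\<lambda>(x, y). frag_of (h x, y))"
  let ?k = "frag_extend (\<lambda>(x, y). frag_of (k x, y))"
  have "map_frag p q (?h z) = ?k (map_frag p q z)" if "z \<in> X" for z
  proof -
    have "Poly_Mapping.keys z \<subseteq> forms A p \<times> forms A q"
      using subsetD[OF tensor_carrier_subset[OF X] that] by simp
    then show ?thesis
      by (induction z rule: frag_induction) (auto simp: map_frag_diff frag_extend_diff h,
          simp add: map_frag_def)
  qed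
  then have "map_tensor p q (?h ` X) = ?k ` map_tensor p q X"
    by (simp add: map_tensor_def image_image)
  then show ?thesis
    unfolding tensor_act_left_def map_tensor_set_mult
    by (simp add: map_tensor_def[of p q "tensor_rels A p q"] tensor_rels_image)
qed

lemma map_tensor_scale:
  "X \<in> carrier (tensor_prod A p q) \<Longrightarrow>
     map_tensor p q (tensor_scale A p q c X) = tensor_scale B p q c (map_tensor p q X)"
  unfolding tensor_scale_def by (rule map_tensor_act_left) (simp_all add: map_scal)

lemma map_tensor_lmult:
  "X \<in> carrier (tensor_prod A p q) \<Longrightarrow> f \<in> forms A 0 \<Longrightarrow>
     map_tensor p q (tensor_lmult A p q f X) = tensor_lmult B p q (\<phi> 0 f) (map_tensor p q X)"
  unfolding tensor_lmult_def using map_wedge[of f 0 _ p] by (intro map_tensor_act_left) simp_all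

lemma is_tensor_map_map_tensor: "is_tensor_map A B p q (\<phi> p) (\<phi> q) (map_tensor p q)"
  unfolding is_tensor_map_def hom_def
  by (simp add: map_tensor_carrier map_tensor_mult map_tensor_scale map_tensor_tensor)

lemma is_tensor_map_unique:
  assumes "is_tensor_map A B p q (\<phi> p) (\<phi> q) T" and "X \<in> carrier (tensor_prod A p q)"
  shows "T X = map_tensor p q X"
proof (rule tensor_prod_hom_eqI[OF tensor_gens_carrier _ _ _ _ assms(2)])
  show "group (tensor_prod B p q)"
    unfolding tensor_prod_def
    by (rule normal.factorgroup_is_group[OF tensor_prod_normal[OF tensor_gens_carrier_target]])
qed (use assms(1) is_tensor_map_map_tensor in \<open>auto simp: is_tensor_map_def\<close>)

theorem left_covariant_derivative_transport:
  assumes "left_covariant_derivative A n N"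
  shows "left_covariant_derivative B n
    (map_tensor 1 n \<circ> N \<circ> inv_into (forms A n) (\<phi> n))"
proof -
  have N: "x \<in> forms A n \<Longrightarrow> N x \<in> carrier (tensor_prod A 1 n)"
    "x \<in> forms A n \<Longrightarrow> y \<in> forms A n \<Longrightarrow> N (x + y) = N x \<otimes>\<^bsub>tensor_prod A 1 n\<^esub> N y"
    "x \<in> forms A n \<Longrightarrow> N (scal A c x) = tensor_scale A 1 n c (N x)"
    "f \<in> forms A 0 \<Longrightarrow> x \<in> forms A n \<Longrightarrow> N (wedge A 0 n f x) =
      tensor A 1 n (dif A 0 f) x \<otimes>\<^bsub>tensor_prod A 1 n\<^esub> tensor_lmult A 1 n f (N x)" for x y c f
    using assms unfolding left_covariant_derivative_def by blast+
  show ?thesis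
    unfolding left_covariant_derivative_def image_forms[symmetric]
  proof (intro conjI ballI allI Pi_I; elim imageE; clarify)
    fix x assume x: "x \<in> forms A n"
    then show "(map_tensor 1 n \<circ> N \<circ> inv_into (forms A n) (\<phi> n)) (\<phi> n x)
        \<in> carrier (tensor_prod B 1 n)"
      by (simp add: inv_map map_tensor_carrier N)
    show "(map_tensor 1 n \<circ> N \<circ> inv_into (forms A n) (\<phi> n)) (scal B c (\<phi> n x)) =
        tensor_scale B 1 n c ((map_tensor 1 n \<circ> N \<circ> inv_into (forms A n) (\<phi> n)) (\<phi> n x))" for c
      using x by (simp add: inv_map map_scal[symmetric] scal_closed map_tensor_scale N)
    show "(map_tensor 1 n \<circ> N \<circ> inv_into (forms A n) (\<phi> n)) (\<phi> n x + \<phi> n y) =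
        (map_tensor 1 n \<circ> N \<circ> inv_into (forms A n) (\<phi> n)) (\<phi> n x) \<otimes>\<^bsub>tensor_prod B 1 n\<^esub>
        (map_tensor 1 n \<circ> N \<circ> inv_into (forms A n) (\<phi> n)) (\<phi> n y)"
      if "y \<in> forms A n" for y
      using x that by (simp add: inv_map map_add[symmetric] add_closed map_tensor_mult N)
    show "(map_tensor 1 n \<circ> N \<circ> inv_into (forms A n) (\<phi> n)) (wedge B 0 n (\<phi> 0 f) (\<phi> n x)) =
        tensor B 1 n (dif B 0 (\<phi> 0 f)) (\<phi> n x) \<otimes>\<^bsub>tensor_prod B 1 n\<^esub>
        tensor_lmult B 1 n (\<phi> 0 f)
          ((map_tensor 1 n \<circ> N \<circ> inv_into (forms A n) (\<phi> n)) (\<phi> n x))"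
      if f: "f \<in> forms A 0" for f
      using x f map_wedge[OF f x] wedge_closed[OF f x] map_dif[OF f]
      by (simp add: inv_map map_tensor_mult map_tensor_tensor map_tensor_lmult N flip: map_wedge)
  qed
qed

end


section \<open>Smooth families\<close>

lemma smooth_fun_differentiable: "smooth_fun f \<Longrightarrow> f differentiable (at t)"
  unfolding smooth_fun_def by (metis funpow_0)

lemma smooth_fun_derivative:
  assumes "smooth_fun f"
  shows "smooth_fun (\<lambda>t. vector_derivative f (at t))"
  unfolding smooth_fun_def
proof (intro allI)
  fix n t
  show "((\<lambda>g s. vector_derivative g (at s)) ^^ n) (\<lambda>t. vector_derivative f (at t))
      differentiable (at t)"
    using assms[unfolded smooth_fun_def, rule_format, of "Suc n" t]
    by (simp only: funpow_Suc_right o_apply)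
qed

text \<open>
  Smoothness is the largest property that implies differentiability and passes to the derivative.
  This avoids any formula for the iterated derivatives of a product.
\<close>

lemma smooth_fun_coinduct:
  assumes "P f"
    and step: "\<And>g. P g \<Longrightarrow> (\<forall>t. g differentiable (at t)) \<and> P (\<lambda>t. vector_derivative g (at t))"
  shows "smooth_fun f"
proof -
  have "P (((\<lambda>g s. vector_derivative g (at s)) ^^ n) f)" for n
    by (induction n) (use assms in auto)
  then show ?thesis
    unfolding smooth_fun_def using step by blast
qed

lemma smooth_fun_const: "smooth_fun (\<lambda>t. c)"
  by (rule smooth_fun_coinduct[where P = "\<lambda>f. \<exists>c. f = (\<lambda>t. c)"]) auto

text \<open>
  Products of smooth functions are not stable under differentiation, but by the Leibniz rule finite
  sums of them are: this is the invariant for the coinduction.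
\<close>

inductive sum_of_products :: "(real \<Rightarrow> 'k::real_normed_algebra) \<Rightarrow> bool" where
  product: "smooth_fun f \<Longrightarrow> smooth_fun g \<Longrightarrow> sum_of_products (\<lambda>t. f t * g t)"
| sum: "sum_of_products f \<Longrightarrow> sum_of_products g \<Longrightarrow> sum_of_products (\<lambda>t. f t + g t)"

lemma smooth_fun_mult:
  fixes f g :: "real \<Rightarrow> 'k::real_normed_algebra"
  assumes "smooth_fun f" and "smooth_fun g"
  shows "smooth_fun (\<lambda>t. f t * g t)"
proof (rule smooth_fun_coinduct[where P = sum_of_products])
  show "sum_of_products (\<lambda>t. f t * g t)"
    using assms by (rule product)
next
  fix h :: "real \<Rightarrow> 'k"
  assume "sum_of_products h"
  then show "(\<forall>t. h differentiable (at t)) \<and> sum_of_products (\<lambda>t. vector_derivative h (at t))"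
  proof induction
    case (product f g)
    have D: "((\<lambda>t. f t * g t) has_vector_derivative
        f t * vector_derivative g (at t) + vector_derivative f (at t) * g t) (at t)" for t
      using product smooth_fun_differentiable
      by (intro has_vector_derivative_mult) (auto simp: vector_derivative_works[symmetric])
    show ?case
      using product smooth_fun_derivative
      by (auto simp: vector_derivative_at[OF D] intro: differentiableI_vector[OF D]
          intro!: sum_of_products.intros)
  next
    case (sum f g)
    then show ?case
      by (auto intro: sum_of_products.sum)
  qed
qed

locale vector_space_over_normed_field = vector_space scale
  for scale :: "'k::real_normed_field \<Rightarrow> 'a::ab_group_add \<Rightarrow> 'a"
begin

lemma tensor_smooth_zero: "(\<lambda>t. 0) \<in> tensor_smooth scale V"
  unfolding tensor_smooth_def by (auto intro!: exI[of _ 0])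

lemma tensor_smooth_add_monomial:
  assumes "\<xi> \<in> tensor_smooth scale V" and "smooth_fun f" and "v \<in> V"
  shows "(\<lambda>t. \<xi> t + scale (f t) v) \<in> tensor_smooth scale V"
proof -
  obtain N :: nat and g w where "\<forall>i<N. smooth_fun (g i) \<and> w i \<in> V"
    and "\<xi> = (\<lambda>t. \<Sum>i<N. scale (g i t) (w i))"
    using assms(1) unfolding tensor_smooth_def by auto
  then show ?thesis
    unfolding tensor_smooth_def using assms(2,3)
    by (intro CollectI exI[of _ "Suc N"] exI[of _ "g(N := f)"] exI[of _ "w(N := v)"])
      (auto simp: less_Suc_eq)
qed

text \<open>
  All further closure properties are proved one monomial \<open>f(t) v\<close> at a time, which avoids
  manipulating the representing sums, in particular the double sum for a bilinear map.
\<close>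

lemma tensor_smooth_induct [consumes 1, case_names zero add]:
  assumes "\<xi> \<in> tensor_smooth scale V"
    and "P (\<lambda>t. 0)"
    and step: "\<And>\<xi> f v. \<xi> \<in> tensor_smooth scale V \<Longrightarrow> P \<xi> \<Longrightarrow> smooth_fun f \<Longrightarrow> v \<in> V \<Longrightarrow>
      P (\<lambda>t. \<xi> t + scale (f t) v)"
  shows "P \<xi>"
proof -
  obtain N :: nat and g w where gw: "\<forall>i<N. smooth_fun (g i) \<and> w i \<in> V"
    and \<xi>: "\<xi> = (\<lambda>t. \<Sum>i<N. scale (g i t) (w i))"
    using assms(1) unfolding tensor_smooth_def by auto
  have "P (\<lambda>t. \<Sum>i<N. scale (g i t) (w i))"
    using gw
  proof (induction N)
    case 0
    then show ?case
      using assms(2) by simp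
  next
    case (Suc N)
    have "(\<lambda>t. \<Sum>i<N. scale (g i t) (w i)) \<in> tensor_smooth scale V"
      unfolding tensor_smooth_def using Suc.prems
      by (intro CollectI exI[of _ N] exI[of _ g] exI[of _ w]) auto
    then show ?case
      using Suc step by simp
  qed
  then show ?thesis
    by (simp add: \<xi>)
qed

lemma tensor_smooth_add:
  assumes "\<xi> \<in> tensor_smooth scale V" and "\<eta> \<in> tensor_smooth scale V"
  shows "(\<lambda>t. \<xi> t + \<eta> t) \<in> tensor_smooth scale V"
  using assms(2,1)
  by (induction rule: tensor_smooth_induct)
    (simp_all add: tensor_smooth_add_monomial flip: add.assoc)

lemma tensor_smooth_smooth_scale:
  assumes "\<xi> \<in> tensor_smooth scale V" and "smooth_fun g"
  shows "(\<lambda>t. scale (g t) (\<xi> t)) \<in> tensor_smooth scale V"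
  using assms
  by (induction rule: tensor_smooth_induct)
    (simp_all add: scale_right_distrib tensor_smooth_zero tensor_smooth_add_monomial smooth_fun_mult)

lemma tensor_smooth_scale:
  "\<xi> \<in> tensor_smooth scale V \<Longrightarrow> (\<lambda>t. scale c (\<xi> t)) \<in> tensor_smooth scale V"
  using tensor_smooth_smooth_scale[OF _ smooth_fun_const] .

lemma tensor_smooth_diff:
  assumes "\<xi> \<in> tensor_smooth scale V" and "\<eta> \<in> tensor_smooth scale V"
  shows "(\<lambda>t. \<xi> t - \<eta> t) \<in> tensor_smooth scale V"
  using tensor_smooth_add[OF assms(1) tensor_smooth_scale[OF assms(2), of "-1"]] by simp

lemma tensor_smooth_value:
  assumes "subspace V" and "\<xi> \<in> tensor_smooth scale V"
  shows "\<xi> t \<in> V"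
  using assms(2,1)
  by (induction rule: tensor_smooth_induct) (simp_all add: subspace_0 subspace_add subspace_scale)

lemma tensor_smooth_time_deriv:
  assumes "\<xi> \<in> tensor_smooth scale V"
  shows "time_deriv scale \<xi> \<in> tensor_smooth scale V"
proof -
  obtain N :: nat and g w where gw: "\<forall>i<N. smooth_fun (g i) \<and> w i \<in> V"
    and \<xi>: "\<xi> = (\<lambda>t. \<Sum>i<N. scale (g i t) (w i))"
    using assms unfolding tensor_smooth_def by auto
  have "time_deriv scale \<xi> = (\<lambda>t. \<Sum>i<N. scale (vector_derivative (g i) (at t)) (w i))"
    unfolding \<xi> using gw by (intro time_deriv_sum vector_space_axioms) simp
  then show ?thesis
    unfolding tensor_smooth_def using gw smooth_fun_derivative
    by (intro CollectI exI[of _ N] exI[of _ "\<lambda>i t. vector_derivative (g i) (at t)"] exI[of _ w])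
      auto
qed

lemma lin_map_zero:
  assumes "lin_map scale V W f" and "subspace V"
  shows "f 0 = 0"
  using assms(1) subspace_0[OF assms(2)] unfolding lin_map_def by (metis scale_zero_left)

lemma lin_map_diff:
  assumes "lin_map scale V W f" and "subspace V" and "x \<in> V" and "y \<in> V"
  shows "f (x - y) = f x - f y"
  using assms subspace_diff[OF assms(2-4)] unfolding lin_map_def
  by (metis add_diff_cancel diff_add_cancel)

lemma tensor_smooth_lin_map:
  assumes f: "lin_map scale V W f" and V: "subspace V" and "\<xi> \<in> tensor_smooth scale V"
  shows "(\<lambda>t. f (\<xi> t)) \<in> tensor_smooth scale W"
  using assms(3)
proof (induction rule: tensor_smooth_induct)
  case zero
  then show ?case
    by (simp add: lin_map_zero[OF f V] tensor_smooth_zero)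
next
  case (add \<xi> g v)
  then have "f (\<xi> t + scale (g t) v) = f (\<xi> t) + scale (g t) (f v)" for t
    using f tensor_smooth_value[OF V] subspace_scale[OF V] unfolding lin_map_def by metis
  moreover have "f v \<in> W"
    using f add unfolding lin_map_def by auto
  ultimately show ?case
    using add by (simp add: tensor_smooth_add_monomial)
qed

text \<open>
  Induction on \<open>\<xi>\<close> alone suffices: a monomial \<open>f(t) v\<close> contributes \<open>f(t) b(v, \<eta>(t))\<close>, a smooth multiple
  of the image of \<open>\<eta>\<close> under the linear map \<open>b v\<close>.
\<close>

lemma tensor_smooth_bilinear:
  assumes left: "\<And>y. y \<in> W \<Longrightarrow> lin_map scale V U (\<lambda>x. b x y)"
    and right: "\<And>x. x \<in> V \<Longrightarrow> lin_map scale W U (b x)"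
    and V: "subspace V" and W: "subspace W"
    and \<xi>: "\<xi> \<in> tensor_smooth scale V" and \<eta>: "\<eta> \<in> tensor_smooth scale W"
  shows "(\<lambda>t. b (\<xi> t) (\<eta> t)) \<in> tensor_smooth scale U"
  using \<xi>
proof (induction rule: tensor_smooth_induct)
  case zero
  then show ?case
    using lin_map_zero[OF left V] tensor_smooth_value[OF W \<eta>] by (simp add: tensor_smooth_zero)
next
  case (add \<xi> f v)
  have "b (\<xi> t + scale (f t) v) (\<eta> t) = b (\<xi> t) (\<eta> t) + scale (f t) (b v (\<eta> t))" for t
    using left[OF tensor_smooth_value[OF W \<eta>], of t] add
      tensor_smooth_value[OF V] subspace_scale[OF V]
    unfolding lin_map_def by metis
  moreover have "(\<lambda>t. scale (f t) (b v (\<eta> t))) \<in> tensor_smooth scale U"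
    using tensor_smooth_lin_map[OF right W \<eta>] add by (intro tensor_smooth_smooth_scale)
  ultimately show ?case
    using tensor_smooth_add add by simp
qed

end

section \<open>The deformation is an isomorphism\<close>

lemma minus_one_powi_square: "(-1 :: 'k::field) powi n * (-1) powi n = 1"
  by (simp flip: power_int_mult_distrib)

text \<open>
  In \<open>d\<^sub>\<alpha> \<I>(\<xi>)\<close> the term \<open>d\<delta>\<xi>\<close> of the Laplacian cancels against the differential of the \<open>dt\<close> component
  of \<open>\<I>(\<xi>)\<close>, leaving \<open>(-1)\<^sup>n \<alpha> \<delta>d\<xi>\<close>, which is the \<open>dt\<close> component that \<open>\<I>\<close> creates from \<open>d\<xi>\<close>. In
  \<open>\<I>(\<xi>) \<and>\<^sub>\<alpha> \<I>(\<eta>)\<close> the terms with \<open>\<delta>\<xi>\<close> and \<open>\<delta>\<eta>\<close> cancel likewise, leaving \<open>\<delta>(\<xi> \<and> \<eta>)\<close> as in \<open>\<I>(\<xi> \<and>\<^sub>0 \<eta>)\<close>.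
\<close>

lemma graded_iso_deform:
  fixes A :: "('k::real_normed_field, 'a::ab_group_add) dga_data"
  assumes "dga A"
    and \<delta>: "\<And>m. lin_map (scal A) (forms A m) (forms A (m - 1)) (\<delta> m)"
  shows "graded_iso (deformed A \<delta> 0) (deformed A \<delta> \<alpha>) (deform_iso A \<delta> \<alpha>)"
proof -
  interpret dga A by fact
  interpret vector_space_over_normed_field "scal A"
    by (intro vector_space_over_normed_field.intro vector_space)
  note sub = subspace_forms
  let ?S = "\<lambda>n. tensor_smooth (scal A) (forms A n)"
  have forms_deformed: "forms (deformed A \<delta> \<beta>) n = ?S n \<times> ?S (n - 1)" for \<beta> n
    by (simp add: deformed_def)
  have scal_deformed: "scal (deformed A \<delta> \<beta>) c (\<xi>, \<xi>') = (\<lambda>t. scal A c (\<xi> t), \<lambda>t. scal A c (\<xi>' t))"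
    for \<beta> c \<xi> \<xi>'
    by (simp add: deformed_def)
  have ops_deformed: "dif (deformed A \<delta> \<beta>) = deformed_dif A \<delta> \<beta>"
      "wedge (deformed A \<delta> \<beta>) = deformed_wedge A \<delta> \<beta>" for \<beta>
    by (simp_all add: deformed_def)
  have val: "\<xi> t \<in> forms A n" if "\<xi> \<in> ?S n" for \<xi> n t
    by (rule tensor_smooth_value[OF sub that])
  have wedge_smooth: "(\<lambda>t. wedge A n m (\<xi> t) (\<eta> t)) \<in> ?S k"
    if "\<xi> \<in> ?S n" "\<eta> \<in> ?S m" "k = n + m" for \<xi> \<eta> n m k
    unfolding that(3)
    by (rule tensor_smooth_bilinear[OF wedge_linear_left wedge_linear_right sub sub that(1,2)])
  have \<delta>_smooth: "(\<lambda>t. \<delta> n (\<xi> t)) \<in> ?S (n - 1)" if "\<xi> \<in> ?S n" for \<xi> n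
    by (rule tensor_smooth_lin_map[OF \<delta> sub that])
  have dif_smooth: "(\<lambda>t. dif A n (\<xi> t)) \<in> ?S (n + 1)" if "\<xi> \<in> ?S n" for \<xi> n
    by (rule tensor_smooth_lin_map[OF dif_linear sub that])
  have \<delta>_forms: "\<delta> n x \<in> forms A (n - 1)" if "x \<in> forms A n" for x n
    using \<delta>[of n] that by (auto simp: lin_map_def)
  have lin_diff_scale: "f (x - scal A c y) = f x - scal A c (f y)"
    if f: "lin_map (scal A) (forms A n) W f" and "x \<in> forms A n" "y \<in> forms A n"
    for f n W x y c
    using lin_map_diff[OF f sub that(2) subspace_scale[OF sub that(3), of c]] f that(3)
    unfolding lin_map_def by simp
  show ?thesis
  proof
    fix n :: int and x x' :: "(real \<Rightarrow> 'a) \<times> (real \<Rightarrow> 'a)"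
    assume x: "x \<in> forms (deformed A \<delta> 0) n"
    obtain \<xi> \<xi>' where x_eq: "x = (\<xi>, \<xi>')" and \<xi>: "\<xi> \<in> ?S n" and \<xi>': "\<xi>' \<in> ?S (n - 1)"
      using x by (auto simp: forms_deformed)
    show "scal (deformed A \<delta> 0) c x \<in> forms (deformed A \<delta> 0) n" for c
      using \<xi> \<xi>' by (simp add: x_eq scal_deformed forms_deformed tensor_smooth_scale)
    show "deform_iso A \<delta> \<alpha> n (scal (deformed A \<delta> 0) c x) =
        scal (deformed A \<delta> \<alpha>) c (deform_iso A \<delta> \<alpha> n x)" for c
      using \<delta>[of n] val[OF \<xi>]
      by (simp add: x_eq scal_deformed deform_iso_def lin_map_def scale_right_diff_distrib
          mult.commute)
    show "dif (deformed A \<delta> 0) n x \<in> forms (deformed A \<delta> 0) (n + 1)"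
      using dif_smooth[OF \<xi>] dif_smooth[OF \<xi>'] tensor_smooth_time_deriv[OF \<xi>]
      by (simp add: x_eq ops_deformed deformed_dif_def forms_deformed
          tensor_smooth_add tensor_smooth_scale)
    show "deform_iso A \<delta> \<alpha> (n + 1) (dif (deformed A \<delta> 0) n x) =
        dif (deformed A \<delta> \<alpha>) n (deform_iso A \<delta> \<alpha> n x)"
      using lin_diff_scale[OF dif_linear val[OF \<xi>'] \<delta>_forms[OF val[OF \<xi>]]]
      by (simp add: x_eq ops_deformed deformed_dif_def deform_iso_def laplacian_def
          power_int_add scale_right_distrib add.commute add.left_commute)
    show "x + x' \<in> forms (deformed A \<delta> 0) n" if "x' \<in> forms (deformed A \<delta> 0) n"
      using that \<xi> \<xi>' by (auto simp: x_eq forms_deformed plus_fun_def tensor_smooth_add)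
    show "deform_iso A \<delta> \<alpha> n (x + x') = deform_iso A \<delta> \<alpha> n x + deform_iso A \<delta> \<alpha> n x'"
      if "x' \<in> forms (deformed A \<delta> 0) n"
      using that \<delta>[of n] val[OF \<xi>] val
      by (auto simp: x_eq forms_deformed plus_fun_def deform_iso_def lin_map_def
          scale_right_distrib fun_eq_iff)
    fix m :: int and y
    assume y: "y \<in> forms (deformed A \<delta> 0) m"
    obtain \<eta> \<eta>' where y_eq: "y = (\<eta>, \<eta>')" and \<eta>: "\<eta> \<in> ?S m" and \<eta>': "\<eta>' \<in> ?S (m - 1)"
      using y by (auto simp: forms_deformed)
    show "wedge (deformed A \<delta> 0) n m x y \<in> forms (deformed A \<delta> 0) (n + m)"
      using \<xi> \<xi>' \<eta> \<eta>'
      by (auto simp: x_eq y_eq ops_deformed deformed_wedge_def forms_deformed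
          intro!: tensor_smooth_add tensor_smooth_scale wedge_smooth)
    \<comment> \<open>The signs are kept opaque, so that the products of them can be rewritten by \<open>cancel\<close>.\<close>
    define a e e' where "a = (of_real \<alpha> :: 'k)" and "e = ((-1) powi n :: 'k)"
      and "e' = ((-1) powi m :: 'k)"
    have signs: "e * e = 1" "e' * e' = 1" "(-1) powi (n + m) = e * e'"
      by (simp_all add: e_def e'_def minus_one_powi_square power_int_add)
    have cancel: "e * e' * a * e = e' * a" "e' * (e * a) = e * e' * a"
      using signs by (simp_all add: algebra_simps)
    have left: "wedge A (n - 1) m (\<xi>' t - scal A (e * a) (\<delta> n (\<xi> t))) (\<eta> t) =
        wedge A (n - 1) m (\<xi>' t) (\<eta> t) - scal A (e * a) (wedge A (n - 1) m (\<delta> n (\<xi> t)) (\<eta> t))"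
      for t
      by (rule lin_diff_scale[OF wedge_linear_left[OF val[OF \<eta>]] val[OF \<xi>'] \<delta>_forms[OF val[OF \<xi>]]])
    have right: "wedge A n (m - 1) (\<xi> t) (\<eta>' t - scal A (e' * a) (\<delta> m (\<eta> t))) =
        wedge A n (m - 1) (\<xi> t) (\<eta>' t) - scal A (e' * a) (wedge A n (m - 1) (\<xi> t) (\<delta> m (\<eta> t)))"
      for t
      by (rule lin_diff_scale[OF wedge_linear_right[OF val[OF \<xi>]] val[OF \<eta>'] \<delta>_forms[OF val[OF \<eta>]]])
    show "deform_iso A \<delta> \<alpha> (n + m) (wedge (deformed A \<delta> 0) n m x y) =
        wedge (deformed A \<delta> \<alpha>) n m (deform_iso A \<delta> \<alpha> n x) (deform_iso A \<delta> \<alpha> m y)"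
      by (simp add: x_eq y_eq ops_deformed deformed_wedge_def deform_iso_def signs left right cancel
          scale_right_diff_distrib diff_add_eq flip: a_def e_def e'_def)
  next
    fix n :: int
    have closed: "deform_iso A \<delta> \<beta> n ` forms (deformed A \<delta> \<gamma>) n \<subseteq> forms (deformed A \<delta> \<gamma>') n"
      for \<beta> \<gamma> \<gamma>'
      by (auto simp: deform_iso_def forms_deformed intro!: tensor_smooth_diff tensor_smooth_scale
          \<delta>_smooth)
    show "bij_betw (deform_iso A \<delta> \<alpha> n) (forms (deformed A \<delta> 0) n) (forms (deformed A \<delta> \<alpha>) n)"
      by (rule bij_betw_byWitness[where f' = "deform_iso A \<delta> (- \<alpha>) n", OF _ _ closed closed])
        (auto simp: deform_iso_def)
  qed
qed

theorem mainTheorem4: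
  fixes A :: "('k::real_normed_field, 'a::ab_group_add) dga_data"
    and \<delta> :: "int \<Rightarrow> 'a \<Rightarrow> 'a" and \<alpha> :: real and n :: int
    and N :: "'a \<Rightarrow> ('a \<times> 'a \<Rightarrow>\<^sub>0 int) set"
    and N0 :: "(real \<Rightarrow> 'a) \<times> (real \<Rightarrow> 'a) \<Rightarrow>
      (((real \<Rightarrow> 'a) \<times> (real \<Rightarrow> 'a)) \<times> ((real \<Rightarrow> 'a) \<times> (real \<Rightarrow> 'a)) \<Rightarrow>\<^sub>0 int) set"
  assumes "dga A"
    and "\<And>m. lin_map (scal A) (forms A m) (forms A (m - 1)) (\<delta> m)"
    and "0 \<le> n"
    and "left_covariant_derivative A n N"
    and "left_covariant_derivative (deformed A \<delta> 0) n N0"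
    and "adds_time A \<delta> n N N0"
  shows "\<exists>T.
    is_tensor_map (deformed A \<delta> 0) (deformed A \<delta> \<alpha>) 1 n (deform_iso A \<delta> \<alpha> 1) (deform_iso A \<delta> \<alpha> n) T \<and>
    (\<forall>T'. is_tensor_map (deformed A \<delta> 0) (deformed A \<delta> \<alpha>) 1 n
            (deform_iso A \<delta> \<alpha> 1) (deform_iso A \<delta> \<alpha> n) T' \<longrightarrow>
          (\<forall>X\<in>carrier (tensor_prod (deformed A \<delta> 0) 1 n). T' X = T X)) \<and>
    left_covariant_derivative (deformed A \<delta> \<alpha>) n
      (T \<circ> N0 \<circ> inv_into (forms (deformed A \<delta> 0) n) (deform_iso A \<delta> \<alpha> n))"
proof -
  interpret graded_iso "deformed A \<delta> 0" "deformed A \<delta> \<alpha>" "deform_iso A \<delta> \<alpha>"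
    by (rule graded_iso_deform[OF assms(1,2)])
  show ?thesis
    using is_tensor_map_map_tensor[of 1 n] is_tensor_map_unique[of 1 n]
      left_covariant_derivative_transport[OF assms(5)]
    by (intro exI[of _ "map_tensor 1 n"]) blast
qed

end
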